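(* Let $a<b$ and $c<d$ be real numbers and let $f:\Delta\to\mathbb{R}$ be a partial differentiable mapping on $\Delta=[a,b]\times[c,d]\subseteq\mathbb{R}^2$, with mixed second partial derivative $f_{st}=\frac{\partial^{2}f}{\partial t\,\partial s}$ on $\Delta$. Let $q>1$ and $1/p+1/q=1$. If $\left|f_{st}\right|^{q}$ is convex on the co-ordinates on $\Delta$, then $$\begin{aligned} &\left|\frac{f(a,c)+f(a,d)+f(b,c)+f(b,d)}{4}+\frac{1}{(b-a)(d-c)}\int_{a}^{b}\int_{c}^{d}f(x,y)\,dy\,dx-A\right|\\ &\le\frac{(b-a)(d-c)}{4^{1+1/p}(p+1)^{2/p}}\Bigg\{\left[\frac{4|f_{st}(a,c)|^{q}+2|f_{st}(a,d)|^{q}+2|f_{st}(b,c)|^{q}+|f_{st}(b,d)|^{q}}{36}\right]^{1/q}\\ &\quad+\left[\frac{2|f_{st}(a,c)|^{q}+|f_{st}(a,d)|^{q}+4|f_{st}(b,c)|^{q}+2|f_{st}(b,d)|^{q}}{36}\right]^{1/q}\\ &\quad+\left[\frac{2|f_{st}(a,c)|^{q}+4|f_{st}(a,d)|^{q}+|f_{st}(b,c)|^{q}+2|f_{st}(b,d)|^{q}}{36}\right]^{1/q}\\ &\quad+\left[\frac{|f_{st}(a,c)|^{q}+2|f_{st}(a,d)|^{q}+2|f_{st}(b,c)|^{q}+4|f_{st}(b,d)|^{q}}{36}\right]^{1/q}\Bigg\}, \end{aligned}$$ where $$A=\frac12\left[\frac{1}{b-a}\int_{a}^{b}\left[f(x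,c)+f(x,d)\right]dx+\frac{1}{d-c}\int_{c}^{d}\left[f(a,y)+f(b,y)\right]dy\right].$$
   Context: "Partial differentiable mapping on $\Delta$" means that the first-order partial derivatives of $f$ and the mixed second-order partial derivative $f_{st}=\frac{\partial^2 f}{\partial t\,\partial s}$ exist on $\Delta$ (one-sided at the boundary), where $t$ denotes the first variable (in $[a,b]$) and $s$ the second variable (in $[c,d]$). A function $h:\Delta\to\mathbb{R}$ is convex on the co-ordinates on $\Delta$ if for every $y\in[c,d]$ the map $x\mapsto h(x,y)$ is convex on $[a,b]$, and for every $x\in[a,b]$ the map $y\mapsto h(x,y)$ is convex on $[c,d]$. *)

theory Defs
  imports "HOL-Analysis.Analysis"
begin

text \<open>
  Partial derivatives of a function on the rectangle \<open>{a..b} \<times> {c..d}\<close> are taken within the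
  respective interval, so they are one-sided on the boundary and depend only on the values of
  the function on the rectangle. As \<^const>\<open>vector_derivative\<close> is total, these operators are
  meaningful only where the corresponding derivative exists.
\<close>

definition partial_t :: "real \<Rightarrow> real \<Rightarrow> (real \<times> real \<Rightarrow> real) \<Rightarrow> real \<times> real \<Rightarrow> real"
  where "partial_t a b f = (\<lambda>(x, y). vector_derivative (\<lambda>t. f (t, y)) (at x within {a..b}))"

definition partial_s :: "real \<Rightarrow> real \<Rightarrow> (real \<times> real \<Rightarrow> real) \<Rightarrow> real \<times> real \<Rightarrow> real"
  where "partial_s c d f = (\<lambda>(x, y). vector_derivative (\<lambda>s. f (x, s)) (at y within {c..d}))"

text \<open>
  The mixed derivative \<open>f\<^sub>s\<^sub>t = \<partial>\<^sup>2f / \<partial>t \<partial>s\<close> is \<open>\<partial>/\<partial>t (\<partial>f/\<partial>s)\<close>: first in the second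
  variable \<open>s\<close>, then in the first variable \<open>t\<close>.
\<close>

definition mixed_partial ::
    "real \<Rightarrow> real \<Rightarrow> real \<Rightarrow> real \<Rightarrow> (real \<times> real \<Rightarrow> real) \<Rightarrow> real \<times> real \<Rightarrow> real"
  where "mixed_partial a b c d f = partial_t a b (partial_s c d f)"

definition partial_differentiable_on_rect ::
    "real \<Rightarrow> real \<Rightarrow> real \<Rightarrow> real \<Rightarrow> (real \<times> real \<Rightarrow> real) \<Rightarrow> bool"
  where "partial_differentiable_on_rect a b c d f \<longleftrightarrow>
    (\<forall>x\<in>{a..b}. \<forall>y\<in>{c..d}.
       (\<lambda>t. f (t, y)) differentiable (at x within {a..b}) \<and>
       (\<lambda>s. f (x, s)) differentiable (at y within {c..d}) \<and>
       (\<lambda>t. partial_s c d f (t, y)) differentiable (at x within {a..b}))"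

definition convex_on_coordinates ::
    "real \<Rightarrow> real \<Rightarrow> real \<Rightarrow> real \<Rightarrow> (real \<times> real \<Rightarrow> real) \<Rightarrow> bool"
  where "convex_on_coordinates a b c d h \<longleftrightarrow>
    (\<forall>y\<in>{c..d}. convex_on {a..b} (\<lambda>x. h (x, y))) \<and>
    (\<forall>x\<in>{a..b}. convex_on {c..d} (\<lambda>y. h (x, y)))"

end

theory Submission
  imports Defs
begin

text \<open>
  Let \<open>T\<^sub>x\<close> and \<open>T\<^sub>y\<close> be the error functionals of the trapezoidal rule in each variable. The left-hand
  side is \<open>\<bar>T\<^sub>y T\<^sub>x f\<bar>\<close>, and \<open>T F = 1 / (\<beta> - \<alpha>) * \<integral> (x - m) * F' x\<close> with \<open>m\<close> the midpoint.
  If \<open>\<bar>F'\<bar> \<le> k powr (1 / q)\<close> with \<open>k\<close> convex, replace \<open>k\<close> by its affine interpolation and the concave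
  power by its tangents at \<open>(2 * k \<alpha> + k \<beta>) / 3\<close> and \<open>(k \<alpha> + 2 * k \<beta>) / 3\<close> on the left and right half of
  the interval. Applying this in \<open>x\<close> yields two powers of functions convex in \<open>y\<close>, so that
  it applies again in \<open>y\<close>. The resulting constant is at most the claimed one because
  \<open>(p + 1) powr (1 / p) \<le> 2\<close>.

  No continuity of \<open>f\<^sub>s\<^sub>t\<close> is available. Convexity makes \<open>f\<^sub>s\<^sub>t\<close> bounded, so the increments of \<open>f\<close> over
  rectangles are bounded by a multiple of the area; this makes \<open>f\<close> jointly continuous and allows
  differentiation of \<open>T\<^sub>x f\<close> under the integral sign by dominated convergence.
\<close>

section \<open>Tangents of concave powers and weighted integrals of affine functions\<close>

lemma powr_le_tangent:
  fixes z m r :: real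
  assumes "0 < r" "r \<le> 1" "0 < m" "0 \<le> z"
  shows "z powr r \<le> m powr r + r * m powr (r - 1) * (z - m)"
proof (cases "z = 0")
  case True
  have "m powr r = m powr (r - 1) * m"
    using assms by (simp add: powr_diff)
  then show ?thesis
    using True assms by (simp add: mult_left_le_one_le)
next
  case False
  \<comment> \<open>Young's inequality with weights \<open>r\<close> and \<open>1 - r\<close> is the
    tangent bound up to the factor \<open>m powr (r - 1)\<close>. It asks for \<open>z > 0\<close>,
    hence the case split.\<close>
  have "z powr r * m powr (1 - r) \<le> r * z + (1 - r) * m"
    using assms False by (intro Youngs_inequality_0) auto
  then have "z powr r * m powr (1 - r) * m powr (r - 1) \<le> (r * z + (1 - r) * m) * m powr (r - 1)"
    by (intro mult_right_mono) auto
  moreover have "m powr (1 - r) * m powr (r - 1) = 1" "m powr r = m powr (r - 1) * m"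
    using assms by (auto simp: powr_diff simp flip: powr_add)
  ultimately show ?thesis
    by (simp add: mult.assoc) (simp add: algebra_simps)
qed

lemma convex_on_le_interpolation:
  fixes k :: "real \<Rightarrow> real"
  assumes "convex_on {\<alpha>..\<beta>} k" "\<alpha> < \<beta>" "x \<in> {\<alpha>..\<beta>}"
  shows "k x \<le> ((\<beta> - x) * k \<alpha> + (x - \<alpha>) * k \<beta>) / (\<beta> - \<alpha>)"
proof -
  have "k x \<le> (k \<beta> - k \<alpha>) / (\<beta> - \<alpha>) * (x - \<alpha>) + k \<alpha>"
    using convex_onD_Icc'[OF assms(1), of x] assms by auto
  also have "\<dots> = ((\<beta> - x) * k \<alpha> + (x - \<alpha>) * k \<beta>) / (\<beta> - \<alpha>)"
    using assms by (simp add: field_simps)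
  finally show ?thesis .
qed

text \<open>These are the two halves of an integral with weight \<open>\<bar>x - m\<bar>\<close>,
  freed of the absolute value. Both follow from one antiderivative, which vanishes at
  \<open>m\<close>.\<close>

lemma has_integral_centred_affine:
  fixes m \<delta> A B :: real
  assumes "0 \<le> \<delta>"
  shows "((\<lambda>x. (x - m) * (A + B * (x - m))) has_integral A * \<delta>\<^sup>2 / 2 + B * \<delta> ^ 3 / 3) {m..m + \<delta>}"
    and "((\<lambda>x. (m - x) * (A + B * (x - m))) has_integral A * \<delta>\<^sup>2 / 2 - B * \<delta> ^ 3 / 3) {m - \<delta>..m}"
proof -
  define P where "P = (\<lambda>x. A * (x - m)\<^sup>2 / 2 + B * (x - m) ^ 3 / 3)"
  have P: "(P has_vector_derivative (x - m) * (A + B * (x - m))) (at x within S)" for x S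
    unfolding P_def has_real_derivative_iff_has_vector_derivative [symmetric]
    by (auto intro!: derivative_eq_intros simp: power2_eq_square) (simp add: field_simps)
  have "((\<lambda>x. (x - m) * (A + B * (x - m))) has_integral P (m + \<delta>) - P m) {m..m + \<delta>}"
    using assms P by (intro fundamental_theorem_of_calculus) auto
  then show "((\<lambda>x. (x - m) * (A + B * (x - m))) has_integral A * \<delta>\<^sup>2 / 2 + B * \<delta> ^ 3 / 3) {m..m + \<delta>}"
    by (simp add: P_def)
  have "((\<lambda>x. (x - m) * (A + B * (x - m))) has_integral P m - P (m - \<delta>)) {m - \<delta>..m}"
    using assms P by (intro fundamental_theorem_of_calculus) auto
  then have "((\<lambda>x. - ((x - m) * (A + B * (x - m)))) has_integral P (m - \<delta>) - P m) {m - \<delta>..m}"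
    by (auto dest: has_integral_neg)
  moreover have "- ((x - m) * y) = (m - x) * y" for x y
    by (simp add: left_diff_distrib)
  ultimately show "((\<lambda>x. (m - x) * (A + B * (x - m))) has_integral A * \<delta>\<^sup>2 / 2 - B * \<delta> ^ 3 / 3) {m - \<delta>..m}"
    by (simp only:) (simp add: P_def)
qed

text \<open>\<open>L\<close> has the end values \<open>u\<close> and \<open>v\<close>. Its values at
  the centroids of the two weighted halves are \<open>(5 * u + v) / 6\<close> and
  \<open>(u + 5 * v) / 6\<close>; tangents there would give a sharper bound. The points
  \<open>(2 * u + v) / 3\<close> and \<open>(u + 2 * v) / 3\<close> produce the coefficients of the
  target instead, and the extra term that they leave has a favourable sign.\<close>

lemma integral_weighted_powr_affine_le:
  fixes \<alpha> \<beta> u v r :: real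
  assumes "\<alpha> < \<beta>" "0 \<le> u" "0 \<le> v" "0 < r" "r \<le> 1"
  defines "L \<equiv> \<lambda>x. ((\<beta> - x) * u + (x - \<alpha>) * v) / (\<beta> - \<alpha>)"
  shows "(\<lambda>x. \<bar>x - (\<alpha> + \<beta>) / 2\<bar> * L x powr r) integrable_on {\<alpha>..\<beta>}" (is ?int)
    and "integral {\<alpha>..\<beta>} (\<lambda>x. \<bar>x - (\<alpha> + \<beta>) / 2\<bar> * L x powr r)
      \<le> (\<beta> - \<alpha>)\<^sup>2 / 8 * (((2 * u + v) / 3) powr r + ((u + 2 * v) / 3) powr r)" (is ?le)
proof -
  define m where "m = (\<alpha> + \<beta>) / 2"
  define \<delta> where "\<delta> = (\<beta> - \<alpha>) / 2"
  define w where "w = (\<lambda>x. \<bar>x - m\<bar> * L x powr r)"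
  have \<delta>: "0 < \<delta>" "\<alpha> = m - \<delta>" "\<beta> = m + \<delta>"
    using assms by (auto simp: m_def \<delta>_def field_simps)
  have L_eq: "L x = (u + v) / 2 + (v - u) / (2 * \<delta>) * (x - m)" for x
    unfolding L_def \<delta>(2,3) using \<delta>(1) by (simp add: field_simps)
  have L_nonneg: "0 \<le> L x" if "x \<in> {\<alpha>..\<beta>}" for x
    using that assms by (auto simp: L_def)
  have int: "w integrable_on {\<alpha>..\<beta>}"
    unfolding w_def
    using assms L_nonneg
    by (intro integrable_continuous_interval continuous_on_mult continuous_on_powr')
       (auto simp: L_def intro!: continuous_intros)
  then show ?int
    by (simp add: w_def m_def)
  define m1 m2 where "m1 = (2 * u + v) / 3" and "m2 = (u + 2 * v) / 3"
  define g1 g2 where "g1 = r * m1 powr (r - 1)" and "g2 = r * m2 powr (r - 1)"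
  \<comment> \<open>The tangent bound needs a positive base point. If one of the points is 0, then
    \<open>u = v = 0\<close> and \<open>L\<close> vanishes; the tangent inequality then reads
    \<open>0 \<le> 0\<close>, since \<open>0 powr s = 0\<close>.\<close>
  have zero: "L x = 0" if "m1 = 0 \<or> m2 = 0" for x
  proof -
    have "u = 0 \<and> v = 0"
      using that assms by (auto simp: m1_def m2_def)
    then show ?thesis by (simp add: L_def)
  qed
  have m_nonneg: "0 \<le> m1" "0 \<le> m2"
    using assms by (auto simp: m1_def m2_def)
  have tangent: "L x powr r \<le> k powr r + r * k powr (r - 1) * (L x - k)"
    if "x \<in> {\<alpha>..\<beta>}" "k = m1 \<or> k = m2" for x k
  proof (cases "k = 0")
    case True
    then show ?thesis using zero[of x] that(2) by auto
  next
    case False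
    then show ?thesis
      using that assms L_nonneg m_nonneg by (intro powr_le_tangent) auto
  qed
  \<comment> \<open>The tangents as affine functions of \<open>x - m\<close>. The terms in
    \<open>(v - u) / 6\<close> arise because \<open>L m - m1 = (v - u) / 6\<close> and
    \<open>L m - m2 = - (v - u) / 6\<close>.\<close>
  define A1 A2 where "A1 = m1 powr r + g1 * (v - u) / 6" and "A2 = m2 powr r - g2 * (v - u) / 6"
  define B1 B2 where "B1 = g1 * ((v - u) / (2 * \<delta>))" and "B2 = g2 * ((v - u) / (2 * \<delta>))"
  have "integral {m - \<delta>..m} w \<le> A1 * \<delta>\<^sup>2 / 2 - B1 * \<delta> ^ 3 / 3"
  proof (rule has_integral_le[OF integrable_integral has_integral_centred_affine(2)])
    show "w integrable_on {m - \<delta>..m}"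
      using int by (rule integrable_on_subinterval) (use \<delta> in auto)
    show "w x \<le> (m - x) * (A1 + B1 * (x - m))" if "x \<in> {m - \<delta>..m}" for x
    proof -
      have "L x powr r \<le> m1 powr r + g1 * (L x - m1)"
        using tangent[of x m1] that \<delta> by (auto simp: g1_def)
      also have "\<dots> = A1 + B1 * (x - m)"
        by (simp add: A1_def B1_def L_eq m1_def) (simp add: algebra_simps add_divide_distrib diff_divide_distrib)
      finally have "\<bar>x - m\<bar> * L x powr r \<le> \<bar>x - m\<bar> * (A1 + B1 * (x - m))"
        by (intro mult_left_mono) auto
      then show ?thesis
        using that by (simp add: w_def abs_if split: if_splits)
    qed
  qed (use \<delta> in auto)
  moreover have "integral {m..m + \<delta>} w \<le> A2 * \<delta>\<^sup>2 / 2 + B2 * \<delta> ^ 3 / 3"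
  proof (rule has_integral_le[OF integrable_integral has_integral_centred_affine(1)])
    show "w integrable_on {m..m + \<delta>}"
      using int by (rule integrable_on_subinterval) (use \<delta> in auto)
    show "w x \<le> (x - m) * (A2 + B2 * (x - m))" if "x \<in> {m..m + \<delta>}" for x
    proof -
      have "L x powr r \<le> m2 powr r + g2 * (L x - m2)"
        using tangent[of x m2] that \<delta> by (auto simp: g2_def)
      also have "\<dots> = A2 + B2 * (x - m)"
        by (simp add: A2_def B2_def L_eq m2_def) (simp add: algebra_simps add_divide_distrib diff_divide_distrib)
      finally have "\<bar>x - m\<bar> * L x powr r \<le> \<bar>x - m\<bar> * (A2 + B2 * (x - m))"
        by (intro mult_left_mono) auto
      then show ?thesis
        using that by (simp add: w_def abs_if split: if_splits)
    qed
  qed (use \<delta> in auto)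
  moreover have "integral {\<alpha>..\<beta>} w = integral {m - \<delta>..m} w + integral {m..m + \<delta>} w"
    using Henstock_Kurzweil_Integration.integral_combine[of \<alpha> m \<beta> w] int \<delta> by simp
  moreover have "B1 * \<delta> ^ 3 = g1 * (v - u) * \<delta>\<^sup>2 / 2" "B2 * \<delta> ^ 3 = g2 * (v - u) * \<delta>\<^sup>2 / 2"
    using \<delta> by (simp_all add: B1_def B2_def power2_eq_square power3_eq_cube)
  ultimately have le: "integral {\<alpha>..\<beta>} w
      \<le> \<delta>\<^sup>2 / 2 * (m1 powr r + m2 powr r) + \<delta>\<^sup>2 / 12 * ((v - u) * (g2 - g1))"
    unfolding A1_def A2_def by (simp add: algebra_simps add_divide_distrib diff_divide_distrib)
  \<comment> \<open>The extra term is not positive: \<open>g1\<close> and \<open>g2\<close> are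
    slopes of a concave power at \<open>m1\<close> and \<open>m2\<close>, so they are ordered
    oppositely to these points, while \<open>m2 - m1 = (v - u) / 3\<close>.\<close>
  have "(v - u) * (g2 - g1) \<le> 0"
  proof (cases "m1 = 0 \<or> m2 = 0")
    case True
    then have "u = v" using assms by (auto simp: m1_def m2_def)
    then show ?thesis by simp
  next
    case False
    then have pos: "0 < m1" "0 < m2" using m_nonneg by auto
    show ?thesis
    proof (cases "u \<le> v")
      case True
      then have "m2 powr (r - 1) \<le> m1 powr (r - 1)"
        using pos assms by (intro powr_mono2') (auto simp: m1_def m2_def)
      then show ?thesis
        using True assms by (simp add: g1_def g2_def mult_nonneg_nonpos)
    next
      case False
      then have "m1 powr (r - 1) \<le> m2 powr (r - 1)"
        using pos assms by (intro powr_mono2') (auto simp: m1_def m2_def)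
      then show ?thesis
        using False assms by (simp add: g1_def g2_def mult_nonpos_nonneg)
    qed
  qed
  then have "\<delta>\<^sup>2 / 12 * ((v - u) * (g2 - g1)) \<le> 0"
    by (rule mult_nonneg_nonpos[rotated]) simp
  with le show ?le
    by (simp add: w_def m_def m1_def m2_def \<delta>_def power_divide)
qed

section \<open>The trapezoidal error in one variable\<close>

definition trapezoid_error :: "real \<Rightarrow> real \<Rightarrow> (real \<Rightarrow> real) \<Rightarrow> real"
  where "trapezoid_error \<alpha> \<beta> F = (F \<alpha> + F \<beta>) / 2 - 1 / (\<beta> - \<alpha>) * integral {\<alpha>..\<beta>} F"

text \<open>Integration by parts, since \<open>(x - m) * F x\<close> has derivative
  \<open>F x + (x - m) * F' x\<close>. The Henstock-Kurzweil integral integrates every derivative,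
  and \<open>F\<close> is continuous, so integrability of the weighted \<open>F'\<close> comes as a
  conclusion.\<close>

lemma has_integral_trapezoid_error:
  fixes F F' :: "real \<Rightarrow> real"
  assumes "\<alpha> \<le> \<beta>"
    and F: "\<And>x. x \<in> {\<alpha>..\<beta>} \<Longrightarrow> (F has_real_derivative F' x) (at x within {\<alpha>..\<beta>})"
  shows "((\<lambda>x. (x - (\<alpha> + \<beta>) / 2) * F' x) has_integral
    (\<beta> - \<alpha>) / 2 * (F \<alpha> + F \<beta>) - integral {\<alpha>..\<beta>} F) {\<alpha>..\<beta>}"
proof -
  define m where "m = (\<alpha> + \<beta>) / 2"
  have "((\<lambda>x. F x + (x - m) * F' x) has_integral (\<beta> - m) * F \<beta> - (\<alpha> - m) * F \<alpha>) {\<alpha>..\<beta>}"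
    using assms(1) unfolding m_def
    by (intro fundamental_theorem_of_calculus)
       (auto intro!: derivative_eq_intros F simp flip: has_real_derivative_iff_has_vector_derivative)
  moreover have "F integrable_on {\<alpha>..\<beta>}"
    using F by (intro integrable_continuous_interval DERIV_continuous_on)
  ultimately have "((\<lambda>x. F x + (x - m) * F' x - F x) has_integral
      (\<beta> - m) * F \<beta> - (\<alpha> - m) * F \<alpha> - integral {\<alpha>..\<beta>} F) {\<alpha>..\<beta>}"
    by (intro has_integral_diff integrable_integral)
  moreover have "(\<beta> - m) * F \<beta> - (\<alpha> - m) * F \<alpha> = (\<beta> - \<alpha>) / 2 * (F \<alpha> + F \<beta>)"
    by (simp add: m_def field_simps)
  ultimately show ?thesis
    by (simp only: m_def add_diff_cancel_left')
qed

lemma trapezoid_error_le: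
  fixes F F' P :: "real \<Rightarrow> real"
  assumes "\<alpha> < \<beta>"
    and F: "\<And>x. x \<in> {\<alpha>..\<beta>} \<Longrightarrow> (F has_real_derivative F' x) (at x within {\<alpha>..\<beta>})"
    and P: "(\<lambda>x. \<bar>x - (\<alpha> + \<beta>) / 2\<bar> * P x) integrable_on {\<alpha>..\<beta>}"
    and le: "\<And>x. x \<in> {\<alpha>..\<beta>} \<Longrightarrow> \<bar>F' x\<bar> \<le> P x"
  shows "\<bar>trapezoid_error \<alpha> \<beta> F\<bar>
    \<le> integral {\<alpha>..\<beta>} (\<lambda>x. \<bar>x - (\<alpha> + \<beta>) / 2\<bar> * P x) / (\<beta> - \<alpha>)"
proof -
  define R where "R = (\<lambda>x. (x - (\<alpha> + \<beta>) / 2) * F' x)"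
  have R: "(R has_integral (\<beta> - \<alpha>) / 2 * (F \<alpha> + F \<beta>) - integral {\<alpha>..\<beta>} F) {\<alpha>..\<beta>}"
    unfolding R_def using assms by (intro has_integral_trapezoid_error) auto
  then have "trapezoid_error \<alpha> \<beta> F = integral {\<alpha>..\<beta>} R / (\<beta> - \<alpha>)"
    using assms(1) by (simp add: integral_unique trapezoid_error_def field_simps)
  moreover have "norm (integral {\<alpha>..\<beta>} R) \<le> integral {\<alpha>..\<beta>} (\<lambda>x. \<bar>x - (\<alpha> + \<beta>) / 2\<bar> * P x)"
    by (rule Henstock_Kurzweil_Integration.integral_norm_bound_integral[OF has_integral_integrable[OF R] P])
       (simp add: R_def abs_mult le mult_left_mono)
  ultimately show ?thesis
    using assms(1) by (simp add: divide_right_mono)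
qed

text \<open>A finite family is allowed because the bound is used twice: in \<open>x\<close> with a
  single power, then in \<open>y\<close> with the two powers that the first use produces.\<close>

lemma trapezoid_error_le_convex:
  fixes F F' :: "real \<Rightarrow> real" and k :: "'i \<Rightarrow> real \<Rightarrow> real"
  assumes "\<alpha> < \<beta>" "0 < r" "r \<le> 1" "0 \<le> C" "finite I"
    and F: "\<And>x. x \<in> {\<alpha>..\<beta>} \<Longrightarrow> (F has_real_derivative F' x) (at x within {\<alpha>..\<beta>})"
    and convex: "\<And>i. i \<in> I \<Longrightarrow> convex_on {\<alpha>..\<beta>} (k i)"
    and nonneg: "\<And>i x. i \<in> I \<Longrightarrow> x \<in> {\<alpha>..\<beta>} \<Longrightarrow> 0 \<le> k i x"
    and le: "\<And>x. x \<in> {\<alpha>..\<beta>} \<Longrightarrow> \<bar>F' x\<bar> \<le> C * (\<Sum>i\<in>I. k i x powr r)"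
  shows "\<bar>trapezoid_error \<alpha> \<beta> F\<bar> \<le> C * (\<beta> - \<alpha>) / 8 *
    (\<Sum>i\<in>I. ((2 * k i \<alpha> + k i \<beta>) / 3) powr r + ((k i \<alpha> + 2 * k i \<beta>) / 3) powr r)"
proof -
  define L where "L = (\<lambda>i x. ((\<beta> - x) * k i \<alpha> + (x - \<alpha>) * k i \<beta>) / (\<beta> - \<alpha>))"
  define w where "w = (\<lambda>i x. \<bar>x - (\<alpha> + \<beta>) / 2\<bar> * L i x powr r)"
  have eq: "(\<lambda>x. \<bar>x - (\<alpha> + \<beta>) / 2\<bar> * (C * (\<Sum>i\<in>I. L i x powr r))) = (\<lambda>x. C * (\<Sum>i\<in>I. w i x))"
    by (simp add: w_def sum_distrib_left algebra_simps)
  have w_int: "w i integrable_on {\<alpha>..\<beta>}"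
    and w_le: "integral {\<alpha>..\<beta>} (w i)
      \<le> (\<beta> - \<alpha>)\<^sup>2 / 8 * (((2 * k i \<alpha> + k i \<beta>) / 3) powr r + ((k i \<alpha> + 2 * k i \<beta>) / 3) powr r)"
    if "i \<in> I" for i
    unfolding w_def L_def using assms(1-3) nonneg[OF that]
    by (intro integral_weighted_powr_affine_le; simp)+
  have "\<bar>trapezoid_error \<alpha> \<beta> F\<bar> \<le> integral {\<alpha>..\<beta>} (\<lambda>x. C * (\<Sum>i\<in>I. w i x)) / (\<beta> - \<alpha>)"
    unfolding eq [symmetric]
  proof (rule trapezoid_error_le[OF assms(1) F])
    show "(\<lambda>x. \<bar>x - (\<alpha> + \<beta>) / 2\<bar> * (C * (\<Sum>i\<in>I. L i x powr r))) integrable_on {\<alpha>..\<beta>}"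
      unfolding eq using assms(5) w_int by (intro integrable_on_mult_right integrable_sum)
    show "\<bar>F' x\<bar> \<le> C * (\<Sum>i\<in>I. L i x powr r)" if x: "x \<in> {\<alpha>..\<beta>}" for x
    proof -
      \<comment> \<open>Passing to the interpolations before integrating makes the majorant
        continuous, which settles its integrability.\<close>
      have "C * (\<Sum>i\<in>I. k i x powr r) \<le> C * (\<Sum>i\<in>I. L i x powr r)"
        unfolding L_def using assms x
        by (intro mult_left_mono sum_mono powr_mono2 convex_on_le_interpolation convex nonneg) auto
      with le[OF x] show ?thesis by linarith
    qed
  qed
  also have "integral {\<alpha>..\<beta>} (\<lambda>x. C * (\<Sum>i\<in>I. w i x)) = C * (\<Sum>i\<in>I. integral {\<alpha>..\<beta>} (w i))"
    using assms(5) w_int by (simp add: integral_sum)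
  also have "\<dots> / (\<beta> - \<alpha>) \<le> C * (\<Sum>i\<in>I. (\<beta> - \<alpha>)\<^sup>2 / 8 *
      (((2 * k i \<alpha> + k i \<beta>) / 3) powr r + ((k i \<alpha> + 2 * k i \<beta>) / 3) powr r)) / (\<beta> - \<alpha>)"
    using assms(1,4) w_le by (intro divide_right_mono mult_left_mono sum_mono) auto
  also have "\<dots> = C * (\<beta> - \<alpha>) / 8 *
      (\<Sum>i\<in>I. ((2 * k i \<alpha> + k i \<beta>) / 3) powr r + ((k i \<alpha> + 2 * k i \<beta>) / 3) powr r)"
  proof -
    have eq: "C * (D\<^sup>2 / 8 * S) / D = C * D / 8 * S" if "D \<noteq> 0" for D S :: real
      using that by (simp add: power2_eq_square)
    show ?thesis
      unfolding sum_distrib_left [symmetric] by (rule eq) (use assms(1) in simp)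
  qed
  finally show ?thesis .
qed

section \<open>Regularity from a bounded mixed derivative\<close>

locale bounded_mixed_derivative =
  fixes a b c d M :: real and f :: "real \<times> real \<Rightarrow> real" and fs D :: "real \<Rightarrow> real \<Rightarrow> real"
  assumes ab: "a < b" and cd: "c < d"
    and cont_fst: "y \<in> {c..d} \<Longrightarrow> continuous_on {a..b} (\<lambda>t. f (t, y))"
    and fs: "x \<in> {a..b} \<Longrightarrow> y \<in> {c..d} \<Longrightarrow>
      ((\<lambda>s. f (x, s)) has_real_derivative fs x y) (at y within {c..d})"
    and D: "x \<in> {a..b} \<Longrightarrow> y \<in> {c..d} \<Longrightarrow>
      ((\<lambda>t. fs t y) has_real_derivative D x y) (at x within {a..b})"
    and D_le: "x \<in> {a..b} \<Longrightarrow> y \<in> {c..d} \<Longrightarrow> \<bar>D x y\<bar> \<le> M"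
begin

text \<open>The mean value bound is applied twice: in \<open>t\<close> it makes \<open>fs\<close>
  Lipschitz with constant \<open>M\<close>, and in \<open>s\<close> it carries this over to
  \<open>f (x, s) - f (x', s)\<close>.\<close>

lemma rectangle_increment_le:
  assumes "x \<in> {a..b}" "x' \<in> {a..b}" "y \<in> {c..d}" "y' \<in> {c..d}"
  shows "\<bar>(f (x, y) - f (x', y)) - (f (x, y') - f (x', y'))\<bar> \<le> M * \<bar>x - x'\<bar> * \<bar>y - y'\<bar>"
proof -
  have "\<bar>fs x s - fs x' s\<bar> \<le> M * \<bar>x - x'\<bar>" if "s \<in> {c..d}" for s
    using field_differentiable_bound[of "{a..b}" "\<lambda>t. fs t s" "\<lambda>t. D t s" M x x'] that assms D D_le
    by auto
  moreover have "((\<lambda>s. f (x, s) - f (x', s)) has_real_derivative fs x s - fs x' s) (at s within {c..d})"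
    if "s \<in> {c..d}" for s
    using that assms by (intro DERIV_diff fs)
  ultimately show ?thesis
    using field_differentiable_bound[of "{c..d}" "\<lambda>s. f (x, s) - f (x', s)" "\<lambda>s. fs x s - fs x' s"
        "M * \<bar>x - x'\<bar>" y y'] assms
    by auto
qed

lemma cont_snd: "x \<in> {a..b} \<Longrightarrow> continuous_on {c..d} (\<lambda>s. f (x, s))"
  by (rule DERIV_continuous_on) (rule fs)

text \<open>Near \<open>(x0, y0)\<close>, \<open>f\<close> is the sum of its two slices through that
  point, minus a constant, plus a rectangle increment \<open>R\<close>. The slices are continuous
  and \<open>R\<close> is at most
  \<open>M * \<bar>x - x0\<bar> * \<bar>y - y0\<bar>\<close>.\<close>

lemma continuous_on_rectangle: "continuous_on ({a..b} \<times> {c..d}) f"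
  unfolding continuous_on_def
proof (rule ballI)
  fix z assume z: "z \<in> {a..b} \<times> {c..d}"
  obtain x0 y0 where z_eq: "z = (x0, y0)" by (cases z)
  with z have xy: "x0 \<in> {a..b}" "y0 \<in> {c..d}" by auto
  define Q where "Q = {a..b} \<times> {c..d}"
  define R where "R = (\<lambda>w. (f (fst w, snd w) - f (x0, snd w)) - (f (fst w, y0) - f (x0, y0)))"
  have x_lim: "(fst \<longlongrightarrow> x0) (at z within Q)" and y_lim: "(snd \<longlongrightarrow> y0) (at z within Q)"
    by (auto intro!: tendsto_eq_intros simp: z_eq)
  have ev: "\<forall>\<^sub>F w in at z within Q. fst w \<in> {a..b}" "\<forall>\<^sub>F w in at z within Q. snd w \<in> {c..d}"
    unfolding eventually_at_filter by (rule always_eventually; auto simp: Q_def)+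
  have "(R \<longlongrightarrow> 0) (at z within Q)"
  proof (rule Lim_null_comparison)
    show "\<forall>\<^sub>F w in at z within Q. norm (R w) \<le> M * \<bar>fst w - x0\<bar> * \<bar>snd w - y0\<bar>"
      unfolding eventually_at_filter
      by (rule always_eventually) (auto simp: R_def Q_def intro!: rectangle_increment_le[simplified] xy[simplified])
    have "((\<lambda>w. M * \<bar>fst w - x0\<bar> * \<bar>snd w - y0\<bar>) \<longlongrightarrow> M * \<bar>x0 - x0\<bar> * \<bar>y0 - y0\<bar>) (at z within Q)"
      by (intro tendsto_intros x_lim y_lim)
    then show "((\<lambda>w. M * \<bar>fst w - x0\<bar> * \<bar>snd w - y0\<bar>) \<longlongrightarrow> 0) (at z within Q)"
      by simp
  qed
  moreover have "((\<lambda>w. f (fst w, y0)) \<longlongrightarrow> f (x0, y0)) (at z within Q)"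
    using continuous_on_tendsto_compose[OF cont_fst[OF xy(2)] x_lim xy(1) ev(1)]
    by simp
  moreover have "((\<lambda>w. f (x0, snd w)) \<longlongrightarrow> f (x0, y0)) (at z within Q)"
    using continuous_on_tendsto_compose[OF cont_snd[OF xy(1)] y_lim xy(2) ev(2)]
    by simp
  ultimately have "((\<lambda>w. R w + f (fst w, y0) + f (x0, snd w) - f (x0, y0)) \<longlongrightarrow>
      0 + f (x0, y0) + f (x0, y0) - f (x0, y0)) (at z within Q)"
    by (intro tendsto_intros)
  then show "(f \<longlongrightarrow> f z) (at z within {a..b} \<times> {c..d})"
    by (simp add: R_def z_eq Q_def)
qed

text \<open>Dominated convergence for the difference quotients \<open>Q i\<close> along an arbitrary
  sequence tending to \<open>y\<close>.\<close>

lemma has_derivative_integral_fst: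
  assumes y: "y \<in> {c..d}"
  shows "((\<lambda>y. integral {a..b} (\<lambda>x. f (x, y))) has_real_derivative integral {a..b} (\<lambda>x. fs x y))
    (at y within {c..d})"
  unfolding has_field_derivative_iff tendsto_at_iff_sequentially
proof (intro allI impI)
  fix X :: "nat \<Rightarrow> real"
  assume X: "\<forall>i. X i \<in> {c..d} - {y}" and X_lim: "X \<longlonglongrightarrow> y"
  define Q where "Q = (\<lambda>i x. (f (x, X i) - f (x, y)) / (X i - y))"
  have Q_lim: "(\<lambda>i. Q i x) \<longlonglongrightarrow> fs x y" if "x \<in> {a..b}" for x
    using fs[OF that y] X X_lim
    unfolding has_field_derivative_iff tendsto_at_iff_sequentially by (auto simp: Q_def comp_def)
  have f_int: "(\<lambda>x. f (x, s)) integrable_on {a..b}" if "s \<in> {c..d}" for s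
    using cont_fst[OF that] by (rule integrable_continuous_interval)
  \<comment> \<open>The dominating constant: at \<open>x = a\<close> the quotients converge and so
    are bounded by some \<open>K\<close>. Moving from \<open>a\<close> to \<open>x\<close> changes
    them by a rectangle increment over \<open>X i - y\<close>, hence by at most
    \<open>M * (b - a)\<close>.\<close>
  have "Bseq (\<lambda>i. Q i a)"
    using Q_lim[of a] ab by (intro convergent_imp_Bseq convergentI) auto
  then obtain K where K: "\<And>i. \<bar>Q i a\<bar> \<le> K"
    by (auto simp: Bseq_def)
  have "(\<lambda>i. integral {a..b} (Q i)) \<longlonglongrightarrow> integral {a..b} (\<lambda>x. fs x y)"
  proof (rule dominated_convergence(2))
    show "Q i integrable_on {a..b}" for i
      unfolding Q_def using X y by (intro integrable_on_divide integrable_diff f_int) auto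
    show "(\<lambda>x. K + M * (b - a)) integrable_on {a..b}"
      by (rule integrable_const_ivl)
    show "norm (Q i x) \<le> K + M * (b - a)" if x: "x \<in> {a..b}" for i x
    proof -
      have ne: "X i \<noteq> y" using X by auto
      have M: "0 \<le> M" using D_le[OF x y] by linarith
      have "Q i x - Q i a = ((f (x, X i) - f (a, X i)) - (f (x, y) - f (a, y))) / (X i - y)"
        by (simp add: Q_def diff_divide_distrib)
      then have "\<bar>Q i x - Q i a\<bar> * \<bar>X i - y\<bar> = \<bar>(f (x, X i) - f (a, X i)) - (f (x, y) - f (a, y))\<bar>"
        using ne by simp
      also have "\<dots> \<le> M * \<bar>x - a\<bar> * \<bar>X i - y\<bar>"
        using X x y ab by (intro rectangle_increment_le) auto
      finally have "\<bar>Q i x - Q i a\<bar> \<le> M * \<bar>x - a\<bar>"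
        using ne by simp
      also have "\<dots> \<le> M * (b - a)"
        using x M by (intro mult_left_mono) auto
      finally show ?thesis using K[of i] by auto
    qed
  qed (rule Q_lim)
  moreover have "integral {a..b} (Q i)
      = (integral {a..b} (\<lambda>x. f (x, X i)) - integral {a..b} (\<lambda>x. f (x, y))) / (X i - y)" for i
    unfolding Q_def using X y by (simp add: f_int Henstock_Kurzweil_Integration.integral_diff)
  ultimately show "((\<lambda>y'. (integral {a..b} (\<lambda>x. f (x, y')) - integral {a..b} (\<lambda>x. f (x, y))) / (y' - y)) \<circ> X)
      \<longlonglongrightarrow> integral {a..b} (\<lambda>x. fs x y)"
    by (simp add: comp_def)
qed

lemma has_derivative_trapezoid_error_fst:
  assumes y: "y \<in> {c..d}"
  shows "((\<lambda>y. trapezoid_error a b (\<lambda>x. f (x, y))) has_real_derivative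
    trapezoid_error a b (\<lambda>x. fs x y)) (at y within {c..d})"
  unfolding trapezoid_error_def using ab y
  by (auto intro!: derivative_eq_intros has_derivative_integral_fst fs)

lemma iterated_trapezoid_error:
  "trapezoid_error c d (\<lambda>y. trapezoid_error a b (\<lambda>x. f (x, y)))
    = (f (a, c) + f (a, d) + f (b, c) + f (b, d)) / 4
      + 1 / ((b - a) * (d - c)) * integral {a..b} (\<lambda>x. integral {c..d} (\<lambda>y. f (x, y)))
      - 1 / 2 * (1 / (b - a) * integral {a..b} (\<lambda>x. f (x, c) + f (x, d))
        + 1 / (d - c) * integral {c..d} (\<lambda>y. f (a, y) + f (b, y)))"
proof -
  have f_int: "(\<lambda>x. f (x, s)) integrable_on {a..b}" if "s \<in> {c..d}" for s
    using cont_fst[OF that] by (rule integrable_continuous_interval)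
  have int_y: "(\<lambda>y. f (a, y) + f (b, y)) integrable_on {c..d}"
    using ab by (intro integrable_add integrable_continuous_interval cont_snd) auto
  have int_int: "(\<lambda>y. integral {a..b} (\<lambda>x. f (x, y))) integrable_on {c..d}"
    by (rule integrable_continuous_interval, rule DERIV_continuous_on) (rule has_derivative_integral_fst)
  \<comment> \<open>Joint continuity enters here, through Fubini: the target integrates over
    \<open>y\<close> first, the iterated error over \<open>x\<close> first.\<close>
  have swap: "integral {a..b} (\<lambda>x. integral {c..d} (\<lambda>y. f (x, y)))
      = integral {c..d} (\<lambda>y. integral {a..b} (\<lambda>x. f (x, y)))"
    using integral_swap_continuous[of a c b d "\<lambda>x y. f (x, y)"] continuous_on_rectangle
    by (simp add: cbox_Pair_eq)
  \<comment> \<open>With the reciprocals named, the remaining identity is polynomial in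
    \<open>P\<close>, \<open>R\<close> and the integrals.\<close>
  define P R where "P = 1 / (b - a)" and "R = 1 / (d - c)"
  have PR: "1 / ((b - a) * (d - c)) = P * R"
    by (simp add: P_def R_def)
  have T: "trapezoid_error a b (\<lambda>x. f (x, y)) = (f (a, y) + f (b, y)) / 2 - P * integral {a..b} (\<lambda>x. f (x, y))" for y
    by (simp add: trapezoid_error_def P_def)
  have J: "integral {c..d} (\<lambda>y. trapezoid_error a b (\<lambda>x. f (x, y)))
      = integral {c..d} (\<lambda>y. f (a, y) + f (b, y)) / 2
        - P * integral {c..d} (\<lambda>y. integral {a..b} (\<lambda>x. f (x, y)))"
    unfolding T
    by (subst Henstock_Kurzweil_Integration.integral_diff)
       (use int_y int_int in \<open>auto intro!: integrable_on_divide integrable_on_mult_right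
          simp: Henstock_Kurzweil_Integration.integral_divide\<close>)
  have "integral {a..b} (\<lambda>x. f (x, c) + f (x, d))
      = integral {a..b} (\<lambda>x. f (x, c)) + integral {a..b} (\<lambda>x. f (x, d))"
    using f_int cd by (intro Henstock_Kurzweil_Integration.integral_add) auto
  then show ?thesis
    unfolding trapezoid_error_def[of c d] J
    unfolding PR swap P_def [symmetric] R_def [symmetric] T
    by (simp add: algebra_simps add_divide_distrib diff_divide_distrib)
qed

end

section \<open>The inequality on the rectangle\<close>

theorem theorem9:
  fixes a b c d p q A :: real and f f_st :: "real \<times> real \<Rightarrow> real"
  assumes "a < b" and "c < d"
    and "partial_differentiable_on_rect a b c d f"
    and "f_st = mixed_partial a b c d f"
    and "q > 1" and "1 / p + 1 / q = 1"
    and "convex_on_coordinates a b c d (\<lambda>z. \<bar>f_st z\<bar> powr q)"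
    and "A = 1 / 2 *
      (1 / (b - a) * integral {a..b} (\<lambda>x. f (x, c) + f (x, d)) +
       1 / (d - c) * integral {c..d} (\<lambda>y. f (a, y) + f (b, y)))"
  shows
    "\<bar>(f (a, c) + f (a, d) + f (b, c) + f (b, d)) / 4
       + 1 / ((b - a) * (d - c)) * integral {a..b} (\<lambda>x. integral {c..d} (\<lambda>y. f (x, y))) - A\<bar>
     \<le> (b - a) * (d - c) / (4 powr (1 + 1 / p) * (p + 1) powr (2 / p)) *
       (((4 * \<bar>f_st (a, c)\<bar> powr q + 2 * \<bar>f_st (a, d)\<bar> powr q
          + 2 * \<bar>f_st (b, c)\<bar> powr q + \<bar>f_st (b, d)\<bar> powr q) / 36) powr (1 / q)
        + ((2 * \<bar>f_st (a, c)\<bar> powr q + \<bar>f_st (a, d)\<bar> powr q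
          + 4 * \<bar>f_st (b, c)\<bar> powr q + 2 * \<bar>f_st (b, d)\<bar> powr q) / 36) powr (1 / q)
        + ((2 * \<bar>f_st (a, c)\<bar> powr q + 4 * \<bar>f_st (a, d)\<bar> powr q
          + \<bar>f_st (b, c)\<bar> powr q + 2 * \<bar>f_st (b, d)\<bar> powr q) / 36) powr (1 / q)
        + ((\<bar>f_st (a, c)\<bar> powr q + 2 * \<bar>f_st (a, d)\<bar> powr q
          + 2 * \<bar>f_st (b, c)\<bar> powr q + 4 * \<bar>f_st (b, d)\<bar> powr q) / 36) powr (1 / q))"
proof -
  define r where "r = 1 / q"
  define h where "h = (\<lambda>x y. \<bar>f_st (x, y)\<bar> powr q)"
  define fs where "fs = (\<lambda>x y. partial_s c d f (x, y))"
  have r: "0 < r" "r \<le> 1"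
    using assms(5) by (auto simp: r_def)
  have h_nonneg: "0 \<le> h x y" for x y
    by (simp add: h_def)
  have f_st_eq: "\<bar>f_st (x, y)\<bar> = h x y powr r" for x y
    using assms(5) by (simp add: h_def r_def powr_powr)
  have convex_fst: "convex_on {a..b} (\<lambda>x. h x y)" if "y \<in> {c..d}" for y
    using assms(7) that by (simp add: convex_on_coordinates_def h_def)
  have convex_snd: "convex_on {c..d} (\<lambda>y. h x y)" if "x \<in> {a..b}" for x
    using assms(7) that by (simp add: convex_on_coordinates_def h_def)
  \<comment> \<open>A function convex in each coordinate is at most the maximum of its corner
    values, so \<open>H powr r\<close> bounds the mixed derivative.\<close>
  define H where "H = max (max (h a c) (h a d)) (max (h b c) (h b d))"
  have h_le: "h x y \<le> H" if "x \<in> {a..b}" "y \<in> {c..d}" for x y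
  proof -
    have "h x y \<le> max (h a y) (h b y)"
      using convex_fst that by (intro convex_on_le_max) auto
    moreover have "h a y \<le> max (h a c) (h a d)" "h b y \<le> max (h b c) (h b d)"
      using convex_snd that assms(1) by (intro convex_on_le_max; auto)+
    ultimately show ?thesis by (auto simp: H_def)
  qed
  interpret bounded_mixed_derivative a b c d "H powr r" f fs "\<lambda>x y. f_st (x, y)"
  proof
    show "a < b" "c < d" by fact+
    fix x y assume y: "y \<in> {c..d}"
    have "\<forall>x\<in>{a..b}. (\<lambda>t. f (t, y)) differentiable (at x within {a..b})"
      using assms(3) y by (simp add: partial_differentiable_on_rect_def)
    then show "continuous_on {a..b} (\<lambda>t. f (t, y))"
      by (simp add: continuous_on_eq_continuous_within differentiable_imp_continuous_within)
    assume x: "x \<in> {a..b}"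
    have "(\<lambda>s. f (x, s)) differentiable (at y within {c..d})"
      "(\<lambda>t. partial_s c d f (t, y)) differentiable (at x within {a..b})"
      using assms(3) x y by (auto simp: partial_differentiable_on_rect_def)
    then show "((\<lambda>s. f (x, s)) has_real_derivative fs x y) (at y within {c..d})"
      "((\<lambda>t. fs t y) has_real_derivative f_st (x, y)) (at x within {a..b})"
      by (simp_all add: vector_derivative_works has_real_derivative_iff_has_vector_derivative
          fs_def partial_s_def assms(4) mixed_partial_def partial_t_def)
    show "\<bar>f_st (x, y)\<bar> \<le> H powr r"
      unfolding f_st_eq using h_le[OF x y] h_nonneg r by (intro powr_mono2) auto
  qed
  \<comment> \<open>The two tangent points that arise in \<open>x\<close>, as functions of
    \<open>y\<close>. As nonnegative combinations of \<open>h a\<close> and \<open>h b\<close> they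
    are again convex.\<close>
  define k1 k2 where "k1 = (\<lambda>y. (2 * h a y + h b y) / 3)" and "k2 = (\<lambda>y. (h a y + 2 * h b y) / 3)"
  have k_convex: "convex_on {c..d} k1" "convex_on {c..d} k2"
    unfolding k1_def k2_def divide_inverse mult.commute[of _ "inverse 3"] using assms(1)
    by (intro convex_on_cmul convex_on_add convex_snd; simp)+
  have k_nonneg: "0 \<le> k1 y" "0 \<le> k2 y" for y
    using h_nonneg by (auto simp: k1_def k2_def add_nonneg_nonneg)
  have fst_le: "\<bar>trapezoid_error a b (\<lambda>x. fs x y)\<bar> \<le> (b - a) / 8 * (k1 y powr r + k2 y powr r)"
    if y: "y \<in> {c..d}" for y
    using trapezoid_error_le_convex[of a b r 1 "{()}" "\<lambda>x. fs x y" "\<lambda>x. f_st (x, y)" "\<lambda>_ x. h x y"]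
      ab r D[OF _ y] convex_fst[OF y] h_nonneg f_st_eq
    by (simp add: k1_def k2_def)
  let ?S = "((2 * k1 c + k1 d) / 3) powr r + ((k1 c + 2 * k1 d) / 3) powr r
    + (((2 * k2 c + k2 d) / 3) powr r + ((k2 c + 2 * k2 d) / 3) powr r)"
  \<comment> \<open>Second use, now in \<open>y\<close>: the constant \<open>(b - a) / 8\<close>
    comes from the first, and \<open>bool\<close> indexes the pair \<open>k1\<close>,
    \<open>k2\<close>.\<close>
  have bound: "\<bar>trapezoid_error c d (\<lambda>y. trapezoid_error a b (\<lambda>x. f (x, y)))\<bar>
      \<le> (b - a) / 8 * (d - c) / 8 * ?S"
    using trapezoid_error_le_convex[of c d r "(b - a) / 8" "UNIV :: bool set"
        "\<lambda>y. trapezoid_error a b (\<lambda>x. f (x, y))" "\<lambda>y. trapezoid_error a b (\<lambda>x. fs x y)"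
        "\<lambda>i. if i then k1 else k2"]
      ab cd r has_derivative_trapezoid_error_fst fst_le k_convex k_nonneg
    by (simp add: UNIV_bool add_ac)
  have p: "p > 1"
  proof -
    have "1 / q < 1" using assms(5) by simp
    then have "0 < 1 / p" "1 / p < 1" using assms(5,6) r unfolding r_def by linarith+
    then show ?thesis by (simp add: zero_less_divide_iff divide_less_eq)
  qed
  \<comment> \<open>Bernoulli's inequality: the tangent at 1 takes the value
    \<open>1 + (1 / p) * p = 2\<close> at \<open>1 + p\<close>.\<close>
  have "(1 + p) powr (1 / p) \<le> 2"
    using powr_le_tangent[of "1 / p" 1 "1 + p"] p by simp
  then have "((1 + p) powr (1 / p))\<^sup>2 \<le> 2\<^sup>2"
    by (intro power_mono) auto
  then have p_le: "(p + 1) powr (2 / p) \<le> 4"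
    using p by (simp add: add.commute power2_eq_square flip: powr_add)
  \<comment> \<open>Two divisions by 3 give the denominator 9; the target has 36, at the price of a
    factor \<open>4 powr r\<close>.\<close>
  have scale: "(X / 9) powr r = 4 powr r * (X / 36) powr r" if "0 \<le> X" for X :: real
    using that by (simp flip: powr_mult)
  let ?T = "((4 * h a c + 2 * h a d + 2 * h b c + h b d) / 36) powr r
        + ((2 * h a c + h a d + 4 * h b c + 2 * h b d) / 36) powr r
        + ((2 * h a c + 4 * h a d + h b c + 2 * h b d) / 36) powr r
        + ((h a c + 2 * h a d + 2 * h b c + 4 * h b d) / 36) powr r"
  have mix: "(2 * k1 c + k1 d) / 3 = (4 * h a c + 2 * h a d + 2 * h b c + h b d) / 9"
    "(k1 c + 2 * k1 d) / 3 = (2 * h a c + 4 * h a d + h b c + 2 * h b d) / 9"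
    "(2 * k2 c + k2 d) / 3 = (2 * h a c + h a d + 4 * h b c + 2 * h b d) / 9"
    "(k2 c + 2 * k2 d) / 3 = (h a c + 2 * h a d + 2 * h b c + 4 * h b d) / 9"
    by (simp_all add: k1_def k2_def field_simps)
  have "?S = 4 powr r * ?T"
    unfolding mix using h_nonneg by (simp add: scale add_nonneg_nonneg distrib_left)
  then have "(b - a) / 8 * (d - c) / 8 * ?S = (b - a) * (d - c) * (4 powr r / 64) * ?T"
    by simp
  also have "\<dots> \<le> (b - a) * (d - c) * (1 / (4 powr (1 + 1 / p) * (p + 1) powr (2 / p))) * ?T"
  proof (intro mult_right_mono mult_left_mono)
    define Y where "Y = 4 powr (1 + 1 / p) * (p + 1) powr (2 / p)"
    \<comment> \<open>As \<open>1 / p + 1 / q = 1\<close>, the powers of 4 combine to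
      \<open>4 powr 2 = 16\<close>. The comparison of constants becomes
      \<open>16 * (p + 1) powr (2 / p) \<le> 64\<close>.\<close>
    have exponent: "r + (1 + 1 / p) = 2"
      using assms(6) by (simp add: r_def)
    have "4 powr r * Y = 4 powr (r + (1 + 1 / p)) * (p + 1) powr (2 / p)"
      unfolding Y_def powr_add by (simp only: mult.assoc)
    then have "4 powr r * Y \<le> 64"
      using p_le unfolding exponent by simp
    moreover have "0 < Y"
      using p by (simp add: Y_def)
    ultimately show "4 powr r / 64 \<le> 1 / (4 powr (1 + 1 / p) * (p + 1) powr (2 / p))"
      unfolding Y_def [symmetric] by (simp add: pos_le_divide_eq)
  qed (use ab cd in auto)
  finally have "(b - a) / 8 * (d - c) / 8 * ?S
      \<le> (b - a) * (d - c) / (4 powr (1 + 1 / p) * (p + 1) powr (2 / p)) * ?T"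
    by simp
  with bound show ?thesis
    unfolding iterated_trapezoid_error assms(8) [symmetric] h_def r_def by linarith
qed

end
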